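(* Let $n\geq 2$ and let $T=\mathbb{R}^n/\mathbb{Z}^n$ denote the standard $n$-torus. Let $f:T\to T$ be any bijection (not assumed continuous) that maps lines to lines as sets, i.e. for every line $\ell\subseteq T$ the image $f(\ell)$ is again a line in $T$. Then $f$ is affine.
   Context: For $X\subseteq\mathbb{R}^n$ (or $x\in\mathbb{R}^n$), write $[X]$ (resp. $[x]$) for its image in $T=\mathbb{R}^n/\mathbb{Z}^n$. A line in $T$ is the image $[L]$ of an affine $1$-dimensional subspace $L\subseteq\mathbb{R}^n$; its direction may be rational or irrational, and it need not pass through $0$. The torus $T$ carries the standard affine structure induced from $\mathbb{R}^n$. A map $f:T\to T$ is affine if it is affine in local affine coordinates, i.e. for every $x_0\in\mathbb{R}^n$ there are a neighborhood $U$ of $x_0$ in $\mathbb{R}^n$, a real $n\times n$ matrix $A$ and $b\in\mathbb{R}^n$ such that $f([x])=[Ax+b]$ for all $x\in U$. *)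

theory Defs
  imports "HOL-Analysis.Analysis"
begin

definition lattice_equiv :: "real ^ 'n \<Rightarrow> real ^ 'n \<Rightarrow> bool"
  where "lattice_equiv x y \<longleftrightarrow> (\<forall>i. (x - y) $ i \<in> \<int>)"

lemma equivp_lattice_equiv: "equivp (lattice_equiv :: real ^ 'n \<Rightarrow> real ^ 'n \<Rightarrow> bool)"
proof (rule equivpI)
  show "reflp (lattice_equiv :: real ^ 'n \<Rightarrow> real ^ 'n \<Rightarrow> bool)"
    by (rule reflpI) (simp add: lattice_equiv_def)
  show "symp (lattice_equiv :: real ^ 'n \<Rightarrow> real ^ 'n \<Rightarrow> bool)"
  proof (rule sympI)
    fix x y :: "real ^ 'n"
    assume "lattice_equiv x y"
    then have "- ((x - y) $ i) \<in> \<int>" for i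
      unfolding lattice_equiv_def by (blast intro: Ints_minus)
    then show "lattice_equiv y x"
      by (simp add: lattice_equiv_def)
  qed
  show "transp (lattice_equiv :: real ^ 'n \<Rightarrow> real ^ 'n \<Rightarrow> bool)"
  proof (rule transpI)
    fix x y z :: "real ^ 'n"
    assume "lattice_equiv x y" and "lattice_equiv y z"
    then have "(x - y) $ i + (y - z) $ i \<in> \<int>" for i
      unfolding lattice_equiv_def by (blast intro: Ints_add)
    then show "lattice_equiv x z"
      by (simp add: lattice_equiv_def)
  qed
qed

text \<open>The torus \<open>\<real>\<^sup>n / \<int>\<^sup>n\<close>, where \<open>n = CARD('n)\<close>.\<close>

quotient_type 'n torus = "real ^ 'n" / lattice_equiv
  by (rule equivp_lattice_equiv)

lift_definition torus_proj :: "real ^ 'n \<Rightarrow> 'n torus" is "\<lambda>x. x" .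

lemma torus_proj_eq_iff: "torus_proj x = torus_proj y \<longleftrightarrow> (\<forall>i. (x - y) $ i \<in> \<int>)"
  by transfer (simp add: lattice_equiv_def)

lemma surj_torus_proj: "surj torus_proj"
proof (rule surjI)
  show "torus_proj (rep_torus t) = t" for t :: "'n::finite torus"
    by (simp add: torus_proj.abs_eq Quotient3_abs_rep[OF Quotient3_torus])
qed

definition torus_line :: "'n::finite torus set \<Rightarrow> bool"
  where "torus_line l \<longleftrightarrow> (\<exists>L. affine L \<and> aff_dim L = 1 \<and> l = torus_proj ` L)"

text \<open>Affine in local affine coordinates; \<open>A\<close> and \<open>b\<close> may depend on the base point \<open>x\<^sub>0\<close>.\<close>

definition torus_affine :: "('n::finite torus \<Rightarrow> 'n torus) \<Rightarrow> bool"
  where "torus_affine f \<longleftrightarrow>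
    (\<forall>x\<^sub>0. \<exists>U (A :: real ^ 'n ^ 'n) b. open U \<and> x\<^sub>0 \<in> U \<and>
      (\<forall>x\<in>U. f (torus_proj x) = torus_proj (A *v x + b)))"

end

theory Submission imports Defs begin

text \<open>
  The proof detects rational structure by counting intersection points, which a bijection preserves.

  \<^item> \<^emph>\<open>Rational lines.\<close> If two lines meet in at least two but finitely many points, then the multiples
    of a common chord return to finitely many points, so a multiple of the chord is a lattice vector
    and the lines close up. A coordinate line meets a suitable rational line in exactly two points;
    hence its image is a rational line (\<open>coordinate_line_image\<close>).

  \<^item> \<^emph>\<open>Rational planes.\<close> Let \<open>l\<^sub>1\<close> and \<open>l\<^sub>2\<close> be distinct coordinate lines through a point. The coordinate
    plane that they span is filled by its lines of irrational slope, and each of these meets both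
    \<open>l\<^sub>1\<close> and \<open>l\<^sub>2\<close> infinitely often. Conversely, two distinct rational lines through a common point
    meet finitely often, and an irrational line that meets both of them infinitely often runs in the
    rational plane that they span (\<open>irrational_direction_in_plane\<close>). So \<open>f\<close> maps the coordinate
    plane into the rational plane spanned by \<open>f(l\<^sub>1)\<close> and \<open>f(l\<^sub>2)\<close>.

  \<^item> \<^emph>\<open>Two-dimensional tori.\<close> In a two-dimensional torus, lines with different directions always meet,
    so disjoint lines are parallel and \<open>f\<close> preserves parallelism. Following horizontal and vertical
    lines gives \<open>f(x, y) = (g(x), h(y))\<close>, and following the parallels to the diagonal shows that \<open>g\<close>
    is additive modulo 1 and that \<open>h\<close> is an integer multiple of \<open>g\<close>. Additive bijections of the
    circle can be wild; the lines of irrational slope exclude this. Such a line is an injective copy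
    of the reals, so it lifts \<open>g\<close> to an additive map \<open>\<psi>\<close> of the reals, which is unique because an
    additive map from the reals into the integers vanishes. Comparing both coordinates along slope
    \<open>\<alpha>\<close> shows that \<open>\<psi>(\<alpha> t)\<close> is a constant multiple of \<open>\<psi>(t)\<close>. Hence \<open>\<psi>\<close> is a scalar multiple of a
    ring endomorphism of the reals, and the only unital one is the identity: \<open>g\<close> is linear.

  \<^item> \<^emph>\<open>All dimensions.\<close> On every translate of a coordinate plane, \<open>f\<close> is therefore affine. The slope of
    \<open>f\<close> along the \<open>j\<close>-th axis is then the same at \<open>p\<close> and at \<open>p + s e\<^sub>i\<close>, so it is constant, and adding
    one coordinate at a time shows that \<open>f\<close> is affine on the whole torus.
\<close>

section \<open>Integers and additive maps\<close>

lemma int_divisible_zero: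
  fixes r :: real
  assumes "\<And>m::nat. m > 0 \<Longrightarrow> r / of_nat m \<in> \<int>"
  shows "r = 0"
proof -
  obtain m :: nat where m: "\<bar>r\<bar> < of_nat m"
    using reals_Archimedean2 by blast
  then have "m > 0"
    by (cases m) auto
  then have "r / of_nat m \<in> \<int>" and "\<bar>r / of_nat m\<bar> < 1"
    using assms m by auto
  then show ?thesis
    using Ints_nonzero_abs_less1 \<open>m > 0\<close> by force
qed

lemma int_multiples_zero:
  fixes r :: real
  assumes "\<And>t. t * r \<in> \<int>"
  shows "r = 0"
proof (rule int_divisible_zero)
  fix m :: nat
  show "r / of_nat m \<in> \<int>"
    using assms[of "1 / of_nat m"] by simp
qed

lemma additive_of_nat:
  fixes h :: "real \<Rightarrow> real"
  assumes "\<And>x y. h (x + y) = h x + h y"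
  shows "h (of_nat m * x) = of_nat m * h x"
proof (induction m)
  case 0
  show ?case using assms[of 0 0] by simp
next
  case (Suc m)
  then show ?case using assms[of x "of_nat m * x"] by (simp add: algebra_simps)
qed

lemma additive_into_Ints_zero:
  fixes h :: "real \<Rightarrow> real"
  assumes add: "\<And>x y. h (x + y) = h x + h y" and int: "\<And>x. h x \<in> \<int>"
  shows "h x = 0"
proof (rule int_divisible_zero)
  fix m :: nat
  assume "m > 0"
  then have "h x / of_nat m = h (x / of_nat m)"
    using additive_of_nat[of h m "x / of_nat m", OF add] by (simp add: field_simps)
  then show "h x / of_nat m \<in> \<int>"
    using int by simp
qed

text \<open>
  Squares go to squares, so the map is monotone; it fixes the rationals, and a monotone map that
  fixes a dense set is the identity.
\<close>

lemma additive_multiplicative_id: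
  fixes h :: "real \<Rightarrow> real"
  assumes add: "\<And>x y. h (x + y) = h x + h y"
    and mult: "\<And>x y. h (x * y) = h x * h y" and one: "h 1 = 1"
  shows "h x = x"
proof -
  have zero: "h 0 = 0"
    using add[of 0 0] by simp
  have neg: "h (- x) = - h x" for x
    using add[of x "- x"] zero by simp
  have nat: "h (of_nat m) = of_nat m" for m
    using additive_of_nat[of h m 1, OF add] one by simp
  have int: "h (of_int k) = of_int k" for k
    using nat neg by (cases k rule: int_cases2) simp_all
  have rat: "h q = q" if "q \<in> \<rat>" for q
  proof -
    obtain a b :: int where q: "b > 0" "q = of_int a / of_int b"
      using \<open>q \<in> \<rat>\<close> by (elim Rats_cases') blast
    then show ?thesis
      using mult[of q "of_int b"] int by (simp add: field_simps)
  qed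
  have pos: "h x \<ge> 0" if "x \<ge> 0" for x
    using mult[of "sqrt x" "sqrt x"] that by simp
  have mono: "h x \<le> h y" if "x \<le> y" for x y
    using pos[of "y - x"] add[of "y - x" x] that by simp
  show ?thesis
  proof (rule ccontr)
    assume "h x \<noteq> x"
    then consider "h x < x" | "x < h x" by linarith
    then show False
    proof cases
      case 1
      then obtain q where "q \<in> \<rat>" "h x < q" "q < x"
        using Rats_dense_in_real by blast
      then show False using mono[of q x] rat by simp
    next
      case 2
      then obtain q where "q \<in> \<rat>" "x < q" "q < h x"
        using Rats_dense_in_real by blast
      then show False using mono[of x q] rat by simp
    qed
  qed
qed

lemma exists_irrational: "\<exists>r::real. r \<notin> \<rat>"
  using countable_rat uncountable_UNIV_real by (metis UNIV_eq_I)

section \<open>Lines in the torus\<close>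

definition lattice :: "(real ^ 'n) set"
  where "lattice = {x. \<forall>i. x $ i \<in> \<int>}"

lemma torus_proj_eq_lattice: "torus_proj x = torus_proj y \<longleftrightarrow> x - y \<in> lattice"
  by (simp add: torus_proj_eq_iff lattice_def)

lemma lattice_closed:
  shows "0 \<in> lattice"
    and "x \<in> lattice \<Longrightarrow> y \<in> lattice \<Longrightarrow> x + y \<in> lattice"
    and "x \<in> lattice \<Longrightarrow> y \<in> lattice \<Longrightarrow> x - y \<in> lattice"
    and "c \<in> \<int> \<Longrightarrow> x \<in> lattice \<Longrightarrow> c *\<^sub>R x \<in> lattice"
    and "axis i 1 \<in> lattice"
  by (auto simp: lattice_def axis_def)

definition tline :: "real ^ 'n::finite \<Rightarrow> real ^ 'n \<Rightarrow> 'n torus set"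
  where "tline p u = range (\<lambda>t. torus_proj (p + t *\<^sub>R u))"

lemma torus_line_iff: "torus_line l \<longleftrightarrow> (\<exists>p u. u \<noteq> 0 \<and> l = tline p u)"
proof
  assume "torus_line l"
  then obtain L where L: "affine L" "aff_dim L = 1" "l = torus_proj ` L"
    unfolding torus_line_def by blast
  then obtain p where p: "p \<in> L"
    by (metis aff_dim_empty equals0I one_neq_neg_one)
  moreover have "L \<noteq> {p}"
    using L by auto
  ultimately obtain q where q: "q \<in> L" "q \<noteq> p"
    by blast
  have "affine hull {p, q} = L"
  proof (rule affine_dim_equal)
    show "affine hull {p, q} \<subseteq> L"
      using p q L by (simp add: hull_minimal)
    show "aff_dim (affine hull {p, q}) = aff_dim L"
      using q L by (simp add: aff_dim_2)
  qed (use L in auto)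
  also have "affine hull {p, q} = range (\<lambda>t. p + t *\<^sub>R (q - p))"
    by (rule affine_hull_2_alt)
  finally have "l = tline p (q - p)"
    using L(3) by (auto simp: tline_def image_image)
  then show "\<exists>p u. u \<noteq> 0 \<and> l = tline p u"
    using q by (intro exI[of _ p] exI[of _ "q - p"]) simp
next
  assume "\<exists>p u. u \<noteq> 0 \<and> l = tline p u"
  then obtain p u where u: "u \<noteq> 0" "l = tline p u"
    by blast
  have "affine hull {p, p + u} = range (\<lambda>t. p + t *\<^sub>R u)"
    using affine_hull_2_alt[of p "p + u"] by simp
  then have "l = torus_proj ` (affine hull {p, p + u})"
    by (simp add: u tline_def image_image)
  moreover have "aff_dim (affine hull {p, p + u}) = 1"
    using u by (simp add: aff_dim_2)
  ultimately show "torus_line l"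
    unfolding torus_line_def using affine_affine_hull by metis
qed

lemma tline_base: "torus_proj p \<in> tline p u"
  unfolding tline_def by (rule range_eqI[of _ _ 0]) simp

lemma tline_shift: "tline (p + s *\<^sub>R u) u = tline p u"
proof -
  have "p + t *\<^sub>R u = p + s *\<^sub>R u + (t - s) *\<^sub>R u" "p + s *\<^sub>R u + t *\<^sub>R u = p + (s + t) *\<^sub>R u" for t
    by (simp_all add: algebra_simps)
  then show ?thesis
    unfolding tline_def by (metis (no_types, lifting) rangeI image_subsetI subset_antisym)
qed

lemma tline_rebase:
  assumes "torus_proj q \<in> tline p u"
  shows "tline p u = tline q u"
proof -
  obtain s where "torus_proj q = torus_proj (p + s *\<^sub>R u)"
    using assms unfolding tline_def by blast
  then have "torus_proj (q + t *\<^sub>R u) = torus_proj (p + s *\<^sub>R u + t *\<^sub>R u)" for t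
    by (simp add: torus_proj_eq_lattice)
  then have "tline q u = tline (p + s *\<^sub>R u) u"
    by (simp add: tline_def)
  then show ?thesis
    by (simp add: tline_shift)
qed

lemma tline_scale:
  assumes "c \<noteq> 0"
  shows "tline p (c *\<^sub>R u) = tline p u"
proof -
  have "t *\<^sub>R u = (t / c) *\<^sub>R (c *\<^sub>R u)" for t
    using assms by simp
  then show ?thesis
    unfolding tline_def by (metis (no_types, lifting) rangeI image_subsetI subset_antisym scaleR_scaleR)
qed

section \<open>Rational lines\<close>

text \<open>
  The lines with such a direction are the closed ones.
\<close>

definition rational_dir :: "real ^ 'n \<Rightarrow> bool"
  where "rational_dir u \<longleftrightarrow> (\<exists>c. c \<noteq> 0 \<and> c *\<^sub>R u \<in> lattice)"

definition indep2 :: "real ^ 'n \<Rightarrow> real ^ 'n \<Rightarrow> bool"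
  where "indep2 a b \<longleftrightarrow> (\<forall>s t. s *\<^sub>R a + t *\<^sub>R b = 0 \<longrightarrow> s = 0 \<and> t = 0)"

lemma indep2_nonzero:
  assumes "indep2 a b"
  shows "a \<noteq> 0" "b \<noteq> 0"
  using assms[unfolded indep2_def, rule_format, of 1 0] assms[unfolded indep2_def, rule_format, of 0 1]
  by auto

lemma dependent_multiple:
  assumes "\<not> indep2 a v" "a \<noteq> 0"
  obtains r where "v = r *\<^sub>R a"
proof -
  obtain s t where st: "s *\<^sub>R a + t *\<^sub>R v = 0" "s \<noteq> 0 \<or> t \<noteq> 0"
    using assms(1) unfolding indep2_def by blast
  then have "t \<noteq> 0"
    using assms(2) by auto
  have "t *\<^sub>R v = t *\<^sub>R ((- s / t) *\<^sub>R a)"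
    using st(1) \<open>t \<noteq> 0\<close> by (simp add: eq_neg_iff_add_eq_0 add.commute)
  then show ?thesis
    using that \<open>t \<noteq> 0\<close> by (metis scaleR_left_imp_eq)
qed

lemma rational_dir_scale: "c \<noteq> 0 \<Longrightarrow> rational_dir (c *\<^sub>R u) \<longleftrightarrow> rational_dir u"
proof -
  assume c: "c \<noteq> 0"
  have "d *\<^sub>R u = (d / c) *\<^sub>R c *\<^sub>R u" for d
    using c by simp
  then show ?thesis
    unfolding rational_dir_def using c by (metis divide_eq_0_iff mult_eq_0_iff scaleR_scaleR)
qed

text \<open>
  The difference of two common points is a multiple of \<open>u\<close> and, modulo the lattice, a multiple of \<open>v\<close>.
  All integer multiples of this chord lead to common points again, and two of them must coincide.
\<close>

lemma rational_dir_if_finite_meet: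
  assumes fin: "finite (tline p u \<inter> tline q v)"
    and xy: "x \<in> tline p u \<inter> tline q v" "y \<in> tline p u \<inter> tline q v" "x \<noteq> y"
  shows "rational_dir u"
proof -
  obtain r where r: "x = torus_proj r"
    using surj_torus_proj by (metis surjD)
  have l: "tline p u = tline r u" "tline q v = tline r v"
    using xy r tline_rebase by blast+
  then obtain s t where s: "y = torus_proj (r + s *\<^sub>R u)" and t: "y = torus_proj (r + t *\<^sub>R v)"
    using xy(2) unfolding l unfolding tline_def by blast
  have st: "s *\<^sub>R u - t *\<^sub>R v \<in> lattice"
    using s t torus_proj_eq_lattice[of "r + s *\<^sub>R u" "r + t *\<^sub>R v"] by simp
  have "s \<noteq> 0"
    using xy r s by auto
  define P where "P k = torus_proj (r + (of_nat k * s) *\<^sub>R u)" for k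
  have "P k \<in> tline r u \<inter> tline r v" for k
  proof -
    have "of_nat k *\<^sub>R (s *\<^sub>R u - t *\<^sub>R v) \<in> lattice"
      using st by (simp add: lattice_closed)
    then have "P k = torus_proj (r + (of_nat k * t) *\<^sub>R v)"
      by (simp add: P_def torus_proj_eq_lattice algebra_simps)
    then have "P k \<in> tline r v"
      unfolding tline_def by blast
    moreover have "P k \<in> tline r u"
      unfolding P_def tline_def by blast
    ultimately show ?thesis
      by blast
  qed
  then have "range P \<subseteq> tline r u \<inter> tline r v"
    by blast
  then have "finite (range P)"
    using fin l by (metis finite_subset)
  then have "\<not> inj P"
    using finite_imageD by auto
  then obtain k k' where k: "P k = P k'" "k \<noteq> k'"
    by (auto simp: inj_def)
  then have "((of_nat k - of_nat k') * s) *\<^sub>R u \<in> lattice"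
    by (simp add: P_def torus_proj_eq_lattice algebra_simps)
  then show ?thesis
    unfolding rational_dir_def using k \<open>s \<noteq> 0\<close>
    by (intro exI[of _ "(of_nat k - of_nat k') * s"]) auto
qed

lemma primitive_multiple:
  assumes "rational_dir u" "u \<noteq> 0"
  shows "\<exists>c. c \<noteq> 0 \<and> c *\<^sub>R u \<in> lattice \<and> (\<forall>s. s *\<^sub>R (c *\<^sub>R u) \<in> lattice \<longrightarrow> s \<in> \<int>)"
proof -
  obtain k where k: "u $ k \<noteq> 0"
    using assms(2) vec_eq_iff[of u 0] by auto
  \<comment> \<open>The admissible multiples form a discrete group; its generator has the least positive \<open>k\<close>-th entry.\<close>
  define Q where "Q m \<longleftrightarrow> m > 0 \<and> (\<exists>c. c *\<^sub>R u \<in> lattice \<and> c * u $ k = of_nat m)" for m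
  have "\<exists>m. Q m"
  proof -
    obtain c where c: "c \<noteq> 0" "c *\<^sub>R u \<in> lattice"
      using assms(1) unfolding rational_dir_def by blast
    then obtain z where z: "c * u $ k = of_int z"
      by (auto simp: lattice_def elim: Ints_cases)
    have "((of_int (sgn z)) * c) *\<^sub>R u \<in> lattice"
      using lattice_closed(4)[of "of_int (sgn z)" "c *\<^sub>R u"] c by simp
    moreover have "(of_int (sgn z) * c) * u $ k = of_nat (nat \<bar>z\<bar>)"
      using z by (simp add: mult.assoc sgn_if)
    moreover have "z \<noteq> 0"
      using c k z by auto
    ultimately have "Q (nat \<bar>z\<bar>)"
      unfolding Q_def by (metis zero_less_abs_iff zero_less_nat_eq)
    then show ?thesis ..
  qed
  then have "Q (LEAST m. Q m)"
    by (metis LeastI)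
  then obtain m c where m: "m = (LEAST m. Q m)" "m > 0" and c: "c *\<^sub>R u \<in> lattice" "c * u $ k = of_nat m"
    unfolding Q_def by blast
  have "s \<in> \<int>" if s: "s *\<^sub>R (c *\<^sub>R u) \<in> lattice" for s
  proof (rule ccontr)
    assume "s \<notin> \<int>"
    define d where "d = frac s * c"
    have "0 < frac s" "frac s < 1"
      using \<open>s \<notin> \<int>\<close> by (simp_all add: frac_lt_1)
    have "d *\<^sub>R u = s *\<^sub>R (c *\<^sub>R u) - of_int \<lfloor>s\<rfloor> *\<^sub>R (c *\<^sub>R u)"
      by (simp add: d_def frac_def algebra_simps)
    then have d: "d *\<^sub>R u \<in> lattice"
      using lattice_closed(3)[OF s lattice_closed(4)[OF Ints_of_int c(1)]] by simp
    then obtain z where z: "d * u $ k = of_int z"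
      by (auto simp: lattice_def elim: Ints_cases)
    then have "of_int z = frac s * of_nat m"
      using c by (simp add: d_def mult.assoc)
    then have "0 < real_of_int z" "real_of_int z < of_nat m"
      using \<open>0 < frac s\<close> \<open>frac s < 1\<close> m(2) by simp_all
    then have "z > 0" "z < int m"
      by linarith+
    then have "nat z < m"
      by simp
    then have "Q (nat z)"
      unfolding Q_def using d z \<open>z > 0\<close> by (intro conjI exI[of _ d]) simp_all
    then show False
      using \<open>nat z < m\<close> m not_less_Least by blast
  qed
  moreover have "c \<noteq> 0"
    using c(2) m(2) by (cases "c = 0") simp_all
  ultimately show ?thesis
    using c(1) by blast
qed

text \<open>
  Choose two rows in which \<open>a\<close> and \<open>b\<close> have a nonzero minor \<open>D\<close>. Cramer's rule in these rows gives
  both the bound \<open>D\<close> on the denominators of coordinates with respect to \<open>a\<close> and \<open>b\<close>, and the map \<open>N\<close>: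
  \<open>D\<close> times the projection along the plane of \<open>a\<close> and \<open>b\<close> onto the remaining rows, which is an integer
  matrix.
\<close>

lemma lattice_plane_equations:
  fixes a b :: "real ^ 'n"
  assumes ab: "a \<in> lattice" "b \<in> lattice" "indep2 a b"
  obtains N :: "real ^ 'n \<Rightarrow> real ^ 'n" and D :: real where "linear N" "\<And>x. x \<in> lattice \<Longrightarrow> N x \<in> lattice"
    "\<And>x. N x = 0 \<longleftrightarrow> (\<exists>s t. x = s *\<^sub>R a + t *\<^sub>R b)"
    "D \<in> \<int>" "D \<noteq> 0"
    "\<And>s t. s *\<^sub>R a + t *\<^sub>R b \<in> lattice \<Longrightarrow> D * s \<in> \<int> \<and> D * t \<in> \<int>"
proof -
  have "\<exists>m k. a $ m * b $ k - a $ k * b $ m \<noteq> 0"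
  proof (rule ccontr)
    assume "\<not> ?thesis"
    then have z: "a $ m * b $ k - a $ k * b $ m = 0" for m k
      by blast
    have "(b $ k) *\<^sub>R a + (- (a $ k)) *\<^sub>R b = 0" for k
      using z[of _ k] by (simp add: vec_eq_iff mult.commute)
    then have "a $ k = 0" for k
      using ab(3) unfolding indep2_def by fastforce
    then have "1 *\<^sub>R a + 0 *\<^sub>R b = 0"
      by (simp add: vec_eq_iff)
    then show False
      using ab(3) unfolding indep2_def by fastforce
  qed
  then obtain m k where mk: "a $ m * b $ k - a $ k * b $ m \<noteq> 0"
    by blast
  define D where "D = a $ m * b $ k - a $ k * b $ m"
  define N where "N x = D *\<^sub>R x - (x $ m * b $ k - x $ k * b $ m) *\<^sub>R a
    - (a $ m * x $ k - a $ k * x $ m) *\<^sub>R b" for x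
  have "linear N"
    by (rule linearI) (simp_all add: N_def algebra_simps)
  moreover have "N x \<in> lattice" if "x \<in> lattice" for x
    using that ab by (simp add: N_def D_def lattice_def)
  moreover have "N x = 0 \<longleftrightarrow> (\<exists>s t. x = s *\<^sub>R a + t *\<^sub>R b)" for x
  proof
    assume "N x = 0"
    then have "D *\<^sub>R x = (x $ m * b $ k - x $ k * b $ m) *\<^sub>R a + (a $ m * x $ k - a $ k * x $ m) *\<^sub>R b"
      by (simp add: N_def algebra_simps)
    then have "inverse D *\<^sub>R (D *\<^sub>R x) = (inverse D * (x $ m * b $ k - x $ k * b $ m)) *\<^sub>R a
      + (inverse D * (a $ m * x $ k - a $ k * x $ m)) *\<^sub>R b"
      by (simp add: scaleR_add_right)
    then show "\<exists>s t. x = s *\<^sub>R a + t *\<^sub>R b"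
      using mk by (auto simp: D_def)
  next
    assume "\<exists>s t. x = s *\<^sub>R a + t *\<^sub>R b"
    then show "N x = 0"
      by (auto simp: N_def D_def vec_eq_iff algebra_simps)
  qed
  moreover have "D \<in> \<int>" "D \<noteq> 0"
    using mk ab by (auto simp: D_def lattice_def)
  moreover have "D * s \<in> \<int> \<and> D * t \<in> \<int>" if st: "s *\<^sub>R a + t *\<^sub>R b \<in> lattice" for s t
  proof -
    have i: "s * a $ i + t * b $ i \<in> \<int>" "a $ i \<in> \<int>" "b $ i \<in> \<int>" for i
      using st ab by (auto simp: lattice_def)
    have "D * s = (s * a $ m + t * b $ m) * b $ k - (s * a $ k + t * b $ k) * b $ m"
      "D * t = (s * a $ k + t * b $ k) * a $ m - (s * a $ m + t * b $ m) * a $ k"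
      by (simp_all add: D_def algebra_simps)
    then show ?thesis
      using i by simp
  qed
  ultimately show ?thesis
    by (rule that)
qed

text \<open>
  Relative to one common point, the parameters of all common points lie in \<open>(1/D)\<int>\<close>, and parameters that
  agree modulo 1 give the same point.
\<close>

lemma finite_meet_rational_lines:
  fixes a b :: "real ^ 'n::finite"
  assumes ab: "a \<in> lattice" "b \<in> lattice" "indep2 a b"
  shows "finite (tline p a \<inter> tline q b)"
proof (cases "tline p a \<inter> tline q b = {}")
  case False
  then obtain r where r: "torus_proj r \<in> tline p a" "torus_proj r \<in> tline q b"
    using surj_torus_proj by (metis disjoint_iff surjD)
  obtain D where D: "D \<in> \<int>" "D \<noteq> 0"
    "\<And>s t. s *\<^sub>R a + t *\<^sub>R b \<in> lattice \<Longrightarrow> D * s \<in> \<int> \<and> D * t \<in> \<int>"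
    using lattice_plane_equations[OF ab] by metis
  define P where "P z = torus_proj (r + (of_int z / D) *\<^sub>R a)" for z
  obtain d :: int where d: "D = of_int d"
    using D by (auto elim: Ints_cases)
  have "tline r a \<inter> tline r b \<subseteq> P ` {0..<\<bar>d\<bar>}"
  proof
    fix x
    assume "x \<in> tline r a \<inter> tline r b"
    then obtain s t where x: "x = torus_proj (r + s *\<^sub>R a)" "x = torus_proj (r + t *\<^sub>R b)"
      unfolding tline_def by blast
    then have "s *\<^sub>R a + (- t) *\<^sub>R b \<in> lattice"
      using torus_proj_eq_lattice[of "r + s *\<^sub>R a" "r + t *\<^sub>R b"] by simp
    then obtain z where z: "D * s = of_int z"
      using D(3) Ints_cases by metis
    have "of_int z = of_int (z div \<bar>d\<bar>) * (of_int \<bar>d\<bar> :: real) + of_int (z mod \<bar>d\<bar>)"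
      by (metis of_int_add of_int_mult div_mult_mod_eq)
    also have "of_int \<bar>d\<bar> = of_int (sgn d) * D"
      by (simp add: d sgn_if)
    finally have "s - of_int (z mod \<bar>d\<bar>) / D = of_int (z div \<bar>d\<bar> * sgn d)"
      using z D(2) by (simp add: field_simps)
    then have "(s - of_int (z mod \<bar>d\<bar>) / D) *\<^sub>R a \<in> lattice"
      using ab by (simp only: lattice_closed Ints_of_int)
    then have "x = P (z mod \<bar>d\<bar>)"
      by (simp add: x P_def torus_proj_eq_lattice algebra_simps)
    moreover have "d \<noteq> 0"
      using D d by auto
    ultimately show "x \<in> P ` {0..<\<bar>d\<bar>}"
      by auto
  qed
  moreover have "tline p a = tline r a" "tline q b = tline r b"
    using r tline_rebase by blast+
  ultimately show ?thesis
    by (auto intro: finite_subset)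
qed simp

lemma two_meets_direction:
  assumes "x \<in> tline p a \<inter> tline q w" "y \<in> tline p a \<inter> tline q w" "x \<noteq> y"
  obtains c s z where "c \<noteq> 0" "z \<in> lattice" "c *\<^sub>R w = s *\<^sub>R a + z"
proof -
  obtain r where r: "x = torus_proj r"
    using surj_torus_proj by (metis surjD)
  have l: "tline p a = tline r a" "tline q w = tline r w"
    using assms r tline_rebase by blast+
  then obtain s t where s: "y = torus_proj (r + s *\<^sub>R a)" and t: "y = torus_proj (r + t *\<^sub>R w)"
    using assms(2) unfolding l unfolding tline_def by blast
  have "t *\<^sub>R w - s *\<^sub>R a \<in> lattice"
    using s t by (simp add: torus_proj_eq_lattice)
  moreover have "t \<noteq> 0"
    using assms r t by auto
  ultimately show ?thesis
    using that[of t "t *\<^sub>R w - s *\<^sub>R a" s] by simp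
qed

lemma rational_dir_lattice_multiple:
  assumes "D \<in> \<int>" "D \<noteq> 0" "D * s \<in> \<int>" "a \<in> lattice" "z \<in> lattice"
  shows "rational_dir (s *\<^sub>R a + z)"
proof -
  have "D *\<^sub>R (s *\<^sub>R a + z) = (D * s) *\<^sub>R a + D *\<^sub>R z"
    by (simp add: algebra_simps)
  then show ?thesis
    unfolding rational_dir_def using assms lattice_closed by metis
qed

text \<open>
  If \<open>w\<close> left the plane of \<open>a\<close> and \<open>b\<close>, its component off that plane would be a multiple of a lattice
  vector in both descriptions, which makes the two scalings commensurable. Eliminating \<open>w\<close> then shows
  that the multiple of \<open>a\<close> is rational, and so is \<open>w\<close>.
\<close>

lemma irrational_direction_in_plane:
  fixes a b :: "real ^ 'n::finite"
  assumes ab: "a \<in> lattice" "b \<in> lattice" "indep2 a b"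
    and z: "c \<noteq> 0" "z \<in> lattice" "c *\<^sub>R w = s *\<^sub>R a + z"
    and z': "c' \<noteq> 0" "z' \<in> lattice" "c' *\<^sub>R w = s' *\<^sub>R b + z'"
    and irr: "\<not> rational_dir w"
  shows "\<exists>s t. w = s *\<^sub>R a + t *\<^sub>R b"
proof -
  obtain N :: "real ^ 'n \<Rightarrow> real ^ 'n" and D where N: "linear N" "\<And>x. x \<in> lattice \<Longrightarrow> N x \<in> lattice"
      "\<And>x. N x = 0 \<longleftrightarrow> (\<exists>s t. x = s *\<^sub>R a + t *\<^sub>R b)"
    and D: "D \<in> \<int>" "D \<noteq> 0"
      "\<And>s t. s *\<^sub>R a + t *\<^sub>R b \<in> lattice \<Longrightarrow> D * s \<in> \<int> \<and> D * t \<in> \<int>"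
    by (rule lattice_plane_equations[OF ab]) blast
  have Nab: "N a = 0" "N b = 0"
  proof -
    have "a = 1 *\<^sub>R a + 0 *\<^sub>R b" "b = 0 *\<^sub>R a + 1 *\<^sub>R b"
      by simp_all
    then show "N a = 0" "N b = 0"
      using N(3) by blast+
  qed
  have "c *\<^sub>R N w = N z" "c' *\<^sub>R N w = N z'"
    using arg_cong[OF z(3), of N] arg_cong[OF z'(3), of N] N(1) Nab
    by (simp_all add: linear_add linear_cmul)
  have "N w = 0"
  proof (rule ccontr)
    assume "N w \<noteq> 0"
    then obtain k where k: "N w $ k \<noteq> 0"
      using vec_eq_iff[of "N w" 0] by auto
    \<comment> \<open>The two lattice points \<open>N z\<close> and \<open>N z'\<close> lie on one line, so \<open>c\<close> and \<open>c'\<close> are commensurable.\<close>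
    define i where "i = N z $ k"
    define i' where "i' = N z' $ k"
    have i: "i = c * N w $ k" "i' = c' * N w $ k"
      by (simp_all add: i_def i'_def flip: \<open>c *\<^sub>R N w = N z\<close> \<open>c' *\<^sub>R N w = N z'\<close>)
    have int: "i \<in> \<int>" "i' \<in> \<int>"
      using N(2)[OF z(2)] N(2)[OF z'(2)] by (simp_all add: i_def i'_def lattice_def)
    have "i' \<noteq> 0"
      using i k z'(1) by simp
    have "i' * c = i * c'"
      using i by simp
    then have "i' *\<^sub>R (c *\<^sub>R w) = i *\<^sub>R (c' *\<^sub>R w)"
      by simp
    then have "(i' * s) *\<^sub>R a + (- (i * s')) *\<^sub>R b = i *\<^sub>R z' - i' *\<^sub>R z"
      unfolding z(3) z'(3) by (simp add: algebra_simps)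
    moreover have "i *\<^sub>R z' - i' *\<^sub>R z \<in> lattice"
      using int z z' by (simp add: lattice_closed)
    ultimately have "D * (i' * s) \<in> \<int>"
      using D(3)[of "i' * s" "- (i * s')"] by simp
    then have "rational_dir (s *\<^sub>R a + z)"
      using rational_dir_lattice_multiple[of "D * i'" s a z] D \<open>i' \<noteq> 0\<close> int ab z by (simp add: mult.assoc)
    then have "rational_dir w"
      using rational_dir_scale[OF z(1), of w] by (simp add: z(3))
    then show False
      using irr by simp
  qed
  then show ?thesis
    using N(3) by blast
qed



section \<open>Line-preserving maps between two-dimensional tori\<close>

text \<open>
  Torus planes are handled through a parametrization \<open>E\<close> by two real coordinates that is periodic with
  respect to the integer lattice, so that one argument covers all rational planes in a torus of any
  dimension. The line runs through \<open>(x, y)\<close> with direction \<open>(u, v)\<close>.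
\<close>

definition pline :: "(real \<Rightarrow> real \<Rightarrow> 'b) \<Rightarrow> real \<Rightarrow> real \<Rightarrow> real \<Rightarrow> real \<Rightarrow> 'b set"
  where "pline E x y u v = range (\<lambda>t. E (x + t * u) (y + t * v))"

lemma pline_memI: "E (x + t * u) (y + t * v) \<in> pline E x y u v"
  by (simp add: pline_def)

lemma pline_swap: "pline (\<lambda>x y. E y x) x y u v = pline E y x v u"
  by (simp add: pline_def)

lemma pline_meet:
  assumes "u * v' - u' * v \<noteq> 0"
  shows "pline E x y u v \<inter> pline E x' y' u' v' \<noteq> {}"
proof -
  define d where "d = u * v' - u' * v"
  define t where "t = ((x' - x) * v' - u' * (y' - y)) / d"
  define s where "s = (v * (x' - x) - u * (y' - y)) / d"
  have d: "d \<noteq> 0"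
    using assms by (simp add: d_def)
  have "d * (x + t * u) = d * (x' + s * u')" "d * (y + t * v) = d * (y' + s * v')"
    using d unfolding t_def s_def by (simp_all add: field_simps) (simp_all add: d_def algebra_simps)
  then have "x + t * u = x' + s * u'" "y + t * v = y' + s * v'"
    using d by simp_all
  then show ?thesis
    using pline_memI[of E x t u y v] pline_memI[of E x' s u' y' v'] by auto
qed

text \<open>
  The source plane and the target plane have their own parametrizations \<open>E\<close> and \<open>E'\<close>, normalized so
  that the map preserves the origin and both axes.
\<close>

locale torus_plane_map =
  fixes E E' :: "real \<Rightarrow> real \<Rightarrow> 'b" and f :: "'b \<Rightarrow> 'b"
  assumes E_eq: "E s t = E s' t' \<longleftrightarrow> s - s' \<in> \<int> \<and> t - t' \<in> \<int>"
    and E'_eq: "E' s t = E' s' t' \<longleftrightarrow> s - s' \<in> \<int> \<and> t - t' \<in> \<int>"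
    and inj: "inj f"
    and line: "(u, v) \<noteq> (0, 0) \<Longrightarrow>
      \<exists>x' y' u' v'. (u', v') \<noteq> (0, 0) \<and> f ` pline E x y u v = pline E' x' y' u' v'"
    and hor: "f ` pline E 0 0 1 0 = pline E' 0 0 1 0"
    and ver: "f ` pline E 0 0 0 1 = pline E' 0 0 0 1"
    and origin: "f (E 0 0) = E' 0 0"
begin

lemma swap: "torus_plane_map (\<lambda>x y. E y x) (\<lambda>x y. E' y x) f"
proof
  fix u v x y :: real
  assume "(u, v) \<noteq> (0, 0)"
  then have "(v, u) \<noteq> (0, 0)" by auto
  then obtain x' y' u' v' where l: "(u', v') \<noteq> (0, 0)" "f ` pline E y x v u = pline E' x' y' u' v'"
    using line[of v u y x] by blast
  show "\<exists>x' y' u' v'. (u', v') \<noteq> (0, 0) \<and>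
    f ` pline (\<lambda>x y. E y x) x y u v = pline (\<lambda>x y. E' y x) x' y' u' v'"
    unfolding pline_swap[of E] pline_swap[of E'] using l by auto
qed (simp_all add: pline_swap[of E] pline_swap[of E'] E_eq E'_eq inj hor ver origin conj_commute)

lemma pline'_rebase:
  assumes "E' x0 y0 \<in> pline E' x y u v"
  shows "pline E' x y u v = pline E' x0 y0 u v"
proof -
  obtain s where s: "x0 - (x + s * u) \<in> \<int>" "y0 - (y + s * v) \<in> \<int>"
    using assms by (auto simp: pline_def E'_eq)
  have "E' (x + t * u) (y + t * v) = E' (x0 + (t - s) * u) (y0 + (t - s) * v)" for t
    using s[THEN Ints_minus] by (simp add: E'_eq algebra_simps)
  moreover have "E' (x0 + t * u) (y0 + t * v) = E' (x + (t + s) * u) (y + (t + s) * v)" for t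
    using s by (simp add: E'_eq algebra_simps)
  ultimately show ?thesis
    unfolding pline_def by (metis (no_types, lifting) rangeI image_subsetI subset_antisym)
qed

text \<open>
  A horizontal line is disjoint from the axis or equal to it. A line in any other than the horizontal
  direction meets the axis without coinciding with it.
\<close>

lemma horizontal_image: "\<exists>h. \<forall>x. \<exists>s. f (E x y) = E' s h"
proof -
  obtain x' y' u' v' where l: "f ` pline E 0 y 1 0 = pline E' x' y' u' v'"
    using line[of 1 0 0 y] by auto
  have "v' = 0"
  proof (rule ccontr)
    assume "v' \<noteq> 0"
    then have "pline E' x' y' u' v' \<inter> pline E' 0 0 1 0 \<noteq> {}"
      by (intro pline_meet) simp
    then have "f ` (pline E 0 y 1 0 \<inter> pline E 0 0 1 0) \<noteq> {}"
      using l hor inj by (simp add: image_Int)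
    then have "y \<in> \<int>"
      by (auto simp: pline_def E_eq)
    then have "E x y = E x 0" for x
      by (simp add: E_eq)
    then have "pline E 0 y 1 0 = pline E 0 0 1 0"
      by (simp add: pline_def)
    then have "pline E' x' y' u' v' = pline E' 0 0 1 0"
      using l hor by simp
    then have "E' (x' + t * u') (y' + t * v') \<in> pline E' 0 0 1 0" for t
      using pline_memI by metis
    then have Z: "y' + t * v' \<in> \<int>" for t
      by (force simp: pline_def E'_eq dest: spec[of _ t])
    have "t * v' \<in> \<int>" for t
      using Ints_diff[OF Z[of t] Z[of 0]] by simp
    then show False
      using int_multiples_zero \<open>v' \<noteq> 0\<close> by blast
  qed
  have "\<exists>s. f (E x y) = E' s y'" for x
  proof -
    have "f (E x y) \<in> pline E' x' y' u' v'"
      using pline_memI[of E 0 x 1 y 0] by (simp flip: l)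
    then show ?thesis
      using \<open>v' = 0\<close> by (auto simp: pline_def)
  qed
  then show ?thesis by blast
qed

lemma coordinates_split: "\<exists>g h. \<forall>x y. f (E x y) = E' (g x) (h y)"
proof -
  obtain h where h: "\<And>x y. \<exists>s. f (E x y) = E' s (h y)"
    using horizontal_image by metis
  obtain g where g: "\<And>x y. \<exists>t. f (E x y) = E' (g x) t"
    using torus_plane_map.horizontal_image[OF swap] by metis
  have "f (E x y) = E' (g x) (h y)" for x y
    using h[of x y] g[of x y] E'_eq by (metis Ints_0 diff_self)
  then show ?thesis by blast
qed

end

text \<open>
  The two coordinates play symmetric roles, so every fact about \<open>g\<close> gives the same fact about \<open>h\<close> by
  exchanging them.
\<close>

locale split_plane_map = torus_plane_map E E' f
  for E E' :: "real \<Rightarrow> real \<Rightarrow> 'b" and f :: "'b \<Rightarrow> 'b" +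
  fixes g h :: "real \<Rightarrow> real"
  assumes f_E: "f (E x y) = E' (g x) (h y)"
begin

lemma swap_split: "split_plane_map (\<lambda>x y. E y x) (\<lambda>x y. E' y x) f h g"
  by (intro split_plane_map.intro swap split_plane_map_axioms.intro) (rule f_E)

lemma g_diff_Ints: "g x - g x' \<in> \<int> \<longleftrightarrow> x - x' \<in> \<int>"
proof -
  have "f (E x 0) = f (E x' 0) \<longleftrightarrow> E x 0 = E x' 0"
    using inj by (simp add: inj_eq)
  then show ?thesis
    by (simp add: f_E E_eq E'_eq)
qed

lemma g_0: "g 0 \<in> \<int>"
  using origin by (simp add: f_E E'_eq)

lemma g_Ints: "g x \<in> \<int> \<longleftrightarrow> x \<in> \<int>"
  using g_diff_Ints[of x 0] g_0 Ints_add[of "g x - g 0" "g 0"] Ints_diff[of "g x" "g 0"] by auto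

lemmas h_0 = split_plane_map.g_0[OF swap_split]
  and h_Ints = split_plane_map.g_Ints[OF swap_split]

lemma line_through:
  assumes "(u, v) \<noteq> (0, 0)"
  obtains u' v' where "(u', v') \<noteq> (0, 0)" "f ` pline E x y u v = pline E' (g x) (h y) u' v'"
proof -
  obtain x' y' u' v' where l: "(u', v') \<noteq> (0, 0)" "f ` pline E x y u v = pline E' x' y' u' v'"
    using line[OF assms, of x y] by blast
  have "E' (g x) (h y) \<in> f ` pline E x y u v"
    using pline_memI[of E x 0 u y v] by (simp flip: f_E)
  then have "pline E' x' y' u' v' = pline E' (g x) (h y) u' v'"
    unfolding l(2) by (rule pline'_rebase)
  then show ?thesis
    using that[OF l(1)] l(2) by simp
qed

lemma line_image_param:
  assumes "f ` pline E x y u v = pline E' (g x) (h y) u' v'"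
  shows "\<exists>s. g (x + t * u) - (g x + s * u') \<in> \<int> \<and> h (y + t * v) - (h y + s * v') \<in> \<int>"
    and "\<exists>t. g (x + t * u) - (g x + s * u') \<in> \<int> \<and> h (y + t * v) - (h y + s * v') \<in> \<int>"
proof -
  have "f (E (x + t * u) (y + t * v)) \<in> pline E' (g x) (h y) u' v'"
    using pline_memI assms by blast
  then show "\<exists>s. g (x + t * u) - (g x + s * u') \<in> \<int> \<and> h (y + t * v) - (h y + s * v') \<in> \<int>"
    by (auto simp: pline_def f_E E'_eq)
  have "E' (g x + s * u') (h y + s * v') \<in> f ` pline E x y u v"
    using pline_memI assms by blast
  then show "\<exists>t. g (x + t * u) - (g x + s * u') \<in> \<int> \<and> h (y + t * v) - (h y + s * v') \<in> \<int>"
    unfolding pline_def by (smt (verit) E'_eq f_E image_iff rangeE)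
qed

lemma line_image_param_0:
  assumes "f ` pline E 0 0 u v = pline E' (g 0) (h 0) u' v'"
  shows "\<exists>s. g (t * u) - s * u' \<in> \<int> \<and> h (t * v) - s * v' \<in> \<int>"
    and "\<exists>t. g (t * u) - s * u' \<in> \<int> \<and> h (t * v) - s * v' \<in> \<int>"
proof -
  have shift: "g x - (g 0 + r) \<in> \<int> \<longleftrightarrow> g x - r \<in> \<int>" "h x - (h 0 + r) \<in> \<int> \<longleftrightarrow> h x - r \<in> \<int>" for x r
    using Ints_add[OF _ g_0, of "g x - (g 0 + r)"] Ints_diff[OF _ g_0, of "g x - r"]
      Ints_add[OF _ h_0, of "h x - (h 0 + r)"] Ints_diff[OF _ h_0, of "h x - r"]
    by (auto simp: algebra_simps)
  show "\<exists>s. g (t * u) - s * u' \<in> \<int> \<and> h (t * v) - s * v' \<in> \<int>"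
    and "\<exists>t. g (t * u) - s * u' \<in> \<int> \<and> h (t * v) - s * v' \<in> \<int>"
    using line_image_param(1)[OF assms, of t] line_image_param(2)[OF assms, of s] by (simp_all add: shift)
qed

text \<open>
  The diagonal meets each axis only at the origin, hence so does its image. The point of the image
  with second coordinate 1 lies on the horizontal axis, so its first coordinate \<open>m\<close> is an integer.
\<close>

lemma diagonal_image:
  obtains m w where "m \<in> \<int>" "w \<noteq> 0" "f ` pline E 0 0 1 1 = pline E' (g 0) (h 0) (m * w) w"
proof -
  obtain u v where l: "f ` pline E 0 0 1 1 = pline E' (g 0) (h 0) u v"
    by (rule line_through[of 1 1 0 0]) auto
  have "v \<noteq> 0"
  proof
    assume "v = 0"
    then have "h (1 / 2) \<in> \<int>"
      using line_image_param_0(1)[OF l, of "1 / 2"] by auto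
    then have "(1 / 2 :: real) \<in> \<int>"
      by (simp add: h_Ints)
    then show False
      by (auto elim!: Ints_cases)
  qed
  obtain t where t: "g t - 1 / v * u \<in> \<int>" "h t - 1 \<in> \<int>"
    using line_image_param_0(2)[OF l, of "1 / v"] \<open>v \<noteq> 0\<close> by auto
  have "h t \<in> \<int>"
    using Ints_add[OF t(2) Ints_1] by simp
  then have "g t \<in> \<int>"
    by (simp add: g_Ints h_Ints)
  then have "u / v \<in> \<int>"
    using Ints_diff[OF _ t(1)] by force
  moreover have "u = u / v * v"
    using \<open>v \<noteq> 0\<close> by simp
  ultimately show ?thesis
    using that l \<open>v \<noteq> 0\<close> by metis
qed

lemma g_proportional_h: "\<exists>m\<in>\<int>. \<forall>t. g t - m * h t \<in> \<int>"
proof -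
  obtain m w where m: "m \<in> \<int>" and l: "f ` pline E 0 0 1 1 = pline E' (g 0) (h 0) (m * w) w"
    using diagonal_image by metis
  have "g t - m * h t \<in> \<int>" for t
  proof -
    obtain s where s: "g t - s * (m * w) \<in> \<int>" "h t - s * w \<in> \<int>"
      using line_image_param_0(1)[OF l, of t] by auto
    show ?thesis
      using Ints_diff[OF s(1) Ints_mult[OF m s(2)]] by (simp add: algebra_simps)
  qed
  then show ?thesis
    using m by blast
qed

text \<open>
  Unless \<open>c\<close> is an integer, the translate of the diagonal by \<open>c\<close> is disjoint from the diagonal, so the
  two images are parallel: along the translate, \<open>g (c + t) - m * h t\<close> is constant modulo 1, while
  \<open>g t - m * h t\<close> vanishes modulo 1 along the diagonal.
\<close>

lemma g_add: "g (c + t) - (g c + g t) \<in> \<int>"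
proof (cases "c \<in> \<int>")
  case True
  then have "g (c + t) - g t \<in> \<int>" "g c \<in> \<int>"
    by (simp_all add: g_diff_Ints g_Ints)
  then show ?thesis
    using Ints_diff by (force simp: algebra_simps)
next
  case False
  obtain m w where m: "m \<in> \<int>" "w \<noteq> 0"
    and diag: "f ` pline E 0 0 1 1 = pline E' (g 0) (h 0) (m * w) w"
    by (rule diagonal_image)
  obtain a b where l: "f ` pline E c 0 1 1 = pline E' (g c) (h 0) a b"
    by (rule line_through[of 1 1 c 0]) auto
  have "a * w - m * w * b = 0"
  proof (rule ccontr)
    assume "a * w - m * w * b \<noteq> 0"
    then have "pline E' (g c) (h 0) a b \<inter> pline E' (g 0) (h 0) (m * w) w \<noteq> {}"
      by (rule pline_meet)
    then have "f ` (pline E c 0 1 1 \<inter> pline E 0 0 1 1) \<noteq> {}"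
      using l diag inj by (simp add: image_Int)
    then obtain s t where "c + s - t \<in> \<int>" "s - t \<in> \<int>"
      by (auto simp: pline_def E_eq)
    then show False
      using False Ints_diff by fastforce
  qed
  then have a: "a = m * b"
    using m by (simp add: algebra_simps)
  obtain s where s: "g (c + t) - (g c + s * a) \<in> \<int>" "h t - (h 0 + s * b) \<in> \<int>"
    using line_image_param(1)[OF l, of t] by auto
  obtain r where r: "g t - r * (m * w) \<in> \<int>" "h t - r * w \<in> \<int>"
    using line_image_param_0(1)[OF diag, of t] by auto
  note mh = Ints_mult[OF m(1) r(2)] Ints_mult[OF m(1) s(2)] Ints_mult[OF m(1) h_0]
  have "(g (c + t) - (g c + s * a)) - (g t - r * (m * w))
      + (m * (h t - r * w) - m * (h t - (h 0 + s * b)) - m * h 0) \<in> \<int>"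
    by (rule Ints_add[OF Ints_diff[OF s(1) r(1)] Ints_diff[OF Ints_diff[OF mh(1,2)] mh(3)]])
  then show ?thesis
    by (simp add: a algebra_simps)
qed

lemmas h_proportional_g = split_plane_map.g_proportional_h[OF swap_split]
  and h_add = split_plane_map.g_add[OF swap_split]

lemma g_of_nat: "g (of_nat k * t) - of_nat k * g t \<in> \<int>"
proof (induction k)
  case 0
  show ?case using g_0 by simp
next
  case (Suc k)
  show ?case
    using Ints_add[OF g_add[of t "of_nat k * t"] Suc] by (simp add: algebra_simps)
qed

lemmas h_of_nat = split_plane_map.g_of_nat[OF swap_split]

text \<open>
  The line of slope \<open>\<alpha>\<close> through the origin has no torsion, so its image is not closed and has a unique
  real parameter \<open>\<phi> t\<close> for the image of the point with parameter \<open>t\<close>. Uniqueness makes \<open>\<phi>\<close> additive,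
  and its multiple by the first component of the direction lifts \<open>g\<close>.
\<close>

lemma irrational_slope_lift:
  assumes "\<alpha> \<notin> \<rat>"
  obtains \<psi> \<beta> where "\<And>s t. \<psi> (s + t) = \<psi> s + \<psi> t" "\<And>t. g t - \<psi> t \<in> \<int>"
    "\<And>t. h (\<alpha> * t) - \<beta> * \<psi> t \<in> \<int>"
proof -
  obtain u v where uv: "(u, v) \<noteq> (0, 0)" and l: "f ` pline E 0 0 1 \<alpha> = pline E' (g 0) (h 0) u v"
    by (rule line_through[of 1 \<alpha> 0 0]) auto
  \<comment> \<open>If the image line closed up after \<open>s\<close>, then for each \<open>m\<close> its \<open>m\<close>-torsion point of parameter \<open>s / m\<close> would come
    from a torsion point of the irrational line, that is, from the origin.\<close>
  have inj_param: "s = 0" if s: "s * u \<in> \<int>" "s * v \<in> \<int>" for s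
  proof -
    have "s * u / of_nat m \<in> \<int> \<and> s * v / of_nat m \<in> \<int>" if "m > 0" for m :: nat
    proof -
      obtain t where t: "g t - s / m * u \<in> \<int>" "h (t * \<alpha>) - s / m * v \<in> \<int>"
        using line_image_param_0(2)[OF l, of "s / m"] by auto
      have "g (m * t) - m * g t + (m * (g t - s / m * u) + s * u) \<in> \<int>"
        by (intro Ints_add g_of_nat Ints_mult t s Ints_of_nat)
      then have gt: "m * t \<in> \<int>"
        using \<open>m > 0\<close> by (simp add: algebra_simps g_Ints)
      have "h (m * (t * \<alpha>)) - m * h (t * \<alpha>) + (m * (h (t * \<alpha>) - s / m * v) + s * v) \<in> \<int>"
        by (intro Ints_add h_of_nat Ints_mult t s Ints_of_nat)
      then have ht: "m * (t * \<alpha>) \<in> \<int>"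
        using \<open>m > 0\<close> by (simp add: algebra_simps h_Ints)
      have "t = 0"
      proof (rule ccontr)
        assume "t \<noteq> 0"
        then have "\<alpha> = m * (t * \<alpha>) / (m * t)"
          using \<open>m > 0\<close> by simp
        also have "\<dots> \<in> \<rat>"
          using gt ht by (meson Ints_subset_Rats Rats_divide subsetD)
        finally show False
          using assms by simp
      qed
      then show ?thesis
        using Ints_diff[OF g_0 t(1)] Ints_diff[OF h_0 t(2)] by simp
    qed
    then have "s * u = 0" "s * v = 0"
      using int_divisible_zero[of "s * u"] int_divisible_zero[of "s * v"] by blast+
    then show ?thesis
      using uv by auto
  qed
  have "\<exists>s. g t - s * u \<in> \<int> \<and> h (t * \<alpha>) - s * v \<in> \<int>" for t
    using line_image_param_0(1)[OF l, of t] by simp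
  then obtain \<phi> where \<phi>: "\<And>t. g t - \<phi> t * u \<in> \<int>" "\<And>t. h (t * \<alpha>) - \<phi> t * v \<in> \<int>"
    by metis
  have add: "\<phi> (s + t) = \<phi> s + \<phi> t" for s t
  proof -
    have "g (s + t) - (g s + g t) - (g (s + t) - \<phi> (s + t) * u) + (g s - \<phi> s * u) + (g t - \<phi> t * u) \<in> \<int>"
      by (intro Ints_add Ints_diff g_add \<phi>)
    then have "(\<phi> (s + t) - \<phi> s - \<phi> t) * u \<in> \<int>"
      by (simp add: algebra_simps)
    moreover have "h (s * \<alpha> + t * \<alpha>) - (h (s * \<alpha>) + h (t * \<alpha>)) - (h ((s + t) * \<alpha>) - \<phi> (s + t) * v)
        + (h (s * \<alpha>) - \<phi> s * v) + (h (t * \<alpha>) - \<phi> t * v) \<in> \<int>"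
      by (intro Ints_add Ints_diff h_add \<phi>)
    then have "(\<phi> (s + t) - \<phi> s - \<phi> t) * v \<in> \<int>"
      by (simp add: algebra_simps)
    ultimately show ?thesis
      using inj_param by fastforce
  qed
  have "u \<noteq> 0"
  proof
    assume "u = 0"
    then have "g (1 / 2) \<in> \<int>"
      using \<phi>(1)[of "1 / 2"] by simp
    then have "(1 / 2 :: real) \<in> \<int>"
      by (simp add: g_Ints)
    then show False
      by (auto elim!: Ints_cases)
  qed
  show ?thesis
  proof (rule that[of "\<lambda>t. \<phi> t * u" "v / u"])
    show "\<phi> (s + t) * u = \<phi> s * u + \<phi> t * u" for s t
      by (simp add: add algebra_simps)
    show "h (\<alpha> * t) - v / u * (\<phi> t * u) \<in> \<int>" for t
      using \<phi>(2)[of t] \<open>u \<noteq> 0\<close> by (simp add: mult.commute)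
  qed (rule \<phi>)
qed

text \<open>
  The lift \<open>\<psi>\<close> is the same for all irrational slopes, and slope \<open>\<alpha>\<close> yields
  \<open>\<psi> (\<alpha> * t) = b * \<psi> t\<close>. A rational factor is a sum of two irrational ones, so this holds for
  every \<open>\<alpha>\<close>. Taking \<open>t = 1\<close> determines \<open>b\<close> and makes \<open>\<psi>\<close>, divided by \<open>\<psi> 1\<close>, multiplicative.
\<close>

lemma g_linear: "\<exists>c. \<forall>x. g x - c * x \<in> \<int>"
proof -
  obtain r :: real where r: "r \<notin> \<rat>"
    using exists_irrational by blast
  obtain \<psi> where add: "\<And>s t. \<psi> (s + t) = \<psi> s + \<psi> t" and \<psi>: "\<And>t. g t - \<psi> t \<in> \<int>"
    using irrational_slope_lift[OF r] by metis
  obtain k where k: "k \<in> \<int>" "\<And>t. h t - k * g t \<in> \<int>"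
    using h_proportional_g by blast
  have half: "(1 / 2 :: real) \<notin> \<int>"
    by (auto elim!: Ints_cases)
  have "k \<noteq> 0"
    using k(2)[of "1 / 2"] h_Ints[of "1 / 2"] half by auto
  have irr: "\<exists>b. \<forall>t. \<psi> (\<alpha> * t) = b * \<psi> t" if \<alpha>: "\<alpha> \<notin> \<rat>" for \<alpha>
  proof -
    obtain \<psi>' \<beta> where add': "\<And>s t. \<psi>' (s + t) = \<psi>' s + \<psi>' t" and \<psi>': "\<And>t. g t - \<psi>' t \<in> \<int>"
      and \<beta>: "\<And>t. h (\<alpha> * t) - \<beta> * \<psi>' t \<in> \<int>"
      using irrational_slope_lift[OF \<alpha>] by metis
    have "\<psi>' t - \<psi> t = 0" for t
    proof (rule additive_into_Ints_zero[of "\<lambda>t. \<psi>' t - \<psi> t"])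
      show "\<psi>' x - \<psi> x \<in> \<int>" for x
        using Ints_diff[OF \<psi>[of x] \<psi>'[of x]] by simp
    qed (simp add: add add')
    then have "\<psi>' = \<psi>"
      by (simp add: fun_eq_iff)
    have eq: "k * \<psi> (\<alpha> * t) - \<beta> * \<psi> t = 0" for t
    proof (rule additive_into_Ints_zero[of "\<lambda>t. k * \<psi> (\<alpha> * t) - \<beta> * \<psi> t"])
      fix x
      have "(h (\<alpha> * x) - \<beta> * \<psi> x) - (h (\<alpha> * x) - k * g (\<alpha> * x)) - k * (g (\<alpha> * x) - \<psi> (\<alpha> * x)) \<in> \<int>"
        using Ints_diff[OF Ints_diff[OF \<beta>[of x] k(2)] Ints_mult[OF k(1) \<psi>]] unfolding \<open>\<psi>' = \<psi>\<close> .
      then show "k * \<psi> (\<alpha> * x) - \<beta> * \<psi> x \<in> \<int>"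
        by (simp add: algebra_simps)
    qed (simp add: add algebra_simps)
    have "\<psi> (\<alpha> * t) = \<beta> / k * \<psi> t" for t
      using eq[of t] \<open>k \<noteq> 0\<close> by (simp add: field_simps)
    then show ?thesis by blast
  qed
  have scale: "\<exists>b. \<forall>t. \<psi> (\<alpha> * t) = b * \<psi> t" for \<alpha>
  proof (cases "\<alpha> \<in> \<rat>")
    case True
    then have "\<alpha> - r \<notin> \<rat>"
      using Rats_diff[of \<alpha> "\<alpha> - r"] r by auto
    then obtain b b' where b: "\<And>t. \<psi> ((\<alpha> - r) * t) = b * \<psi> t" "\<And>t. \<psi> (r * t) = b' * \<psi> t"
      using irr r by metis
    have "\<psi> (\<alpha> * t) = (b + b') * \<psi> t" for t
    proof -
      have "\<alpha> * t = (\<alpha> - r) * t + r * t"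
        by (simp add: algebra_simps)
      then show ?thesis
        using b by (simp only: add distrib_right)
    qed
    then show ?thesis by blast
  qed (rule irr)
  define c where "c = \<psi> 1"
  have "c \<noteq> 0"
  proof
    assume "c = 0"
    then have "\<psi> (1 / 2) = 0"
      using add[of "1 / 2" "1 / 2"] by (simp add: c_def)
    then have "g (1 / 2) \<in> \<int>"
      using \<psi>[of "1 / 2"] by simp
    then show False
      using half by (simp add: g_Ints)
  qed
  have mult: "\<psi> (x * y) = \<psi> x * \<psi> y / c" for x y
  proof -
    obtain b where b: "\<And>t. \<psi> (x * t) = b * \<psi> t"
      using scale by blast
    show ?thesis
      using b[of 1] b[of y] \<open>c \<noteq> 0\<close> by (simp add: c_def)
  qed
  have "\<psi> x / c = x" for x
  proof (rule additive_multiplicative_id[of "\<lambda>x. \<psi> x / c"])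
    show "\<psi> 1 / c = 1"
      using \<open>c \<noteq> 0\<close> by (simp add: c_def)
  qed (simp_all add: add mult add_divide_distrib)
  then have "\<psi> x = c * x" for x
    using \<open>c \<noteq> 0\<close> by (simp add: field_simps)
  then show ?thesis
    using \<psi> by metis
qed

end

context torus_plane_map
begin

lemma linear_in_coordinates: "\<exists>c d. \<forall>x y. f (E x y) = E' (c * x) (d * y)"
proof -
  obtain g h where "\<And>x y. f (E x y) = E' (g x) (h y)"
    using coordinates_split by blast
  then interpret split_plane_map E E' f g h
    by unfold_locales
  obtain c d where "\<And>x. g x - c * x \<in> \<int>" "\<And>y. h y - d * y \<in> \<int>"
    using g_linear split_plane_map.g_linear[OF swap_split] by metis
  then have "f (E x y) = E' (c * x) (d * y)" for x y
    by (simp add: f_E E'_eq)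
  then show ?thesis by blast
qed

end



section \<open>Coordinate planes map to rational planes\<close>

lemma axis_comb_nth:
  "i \<noteq> j \<Longrightarrow> (s *\<^sub>R axis i 1 + t *\<^sub>R axis j (1::real)) $ i = s"
  "i \<noteq> j \<Longrightarrow> (s *\<^sub>R axis i 1 + t *\<^sub>R axis j (1::real)) $ j = t"
  by (simp_all add: axis_def)

lemma axis_comb_lattice:
  assumes "i \<noteq> j"
  shows "s *\<^sub>R axis i 1 + t *\<^sub>R axis j 1 \<in> lattice \<longleftrightarrow> s \<in> \<int> \<and> t \<in> \<int>"
proof
  assume "s *\<^sub>R axis i 1 + t *\<^sub>R axis j 1 \<in> lattice"
  then show "s \<in> \<int> \<and> t \<in> \<int>"
    using axis_comb_nth[OF assms, of s t] unfolding lattice_def by (metis mem_Collect_eq)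
qed (simp add: lattice_closed)

lemma coordinate_lines_meet:
  fixes p :: "real ^ 'n::finite"
  assumes "i \<noteq> j"
  shows "tline p (axis i 1) \<inter> tline p (axis j 1) = {torus_proj p}"
proof
  show "tline p (axis i 1) \<inter> tline p (axis j 1) \<subseteq> {torus_proj p}"
  proof
    fix x
    assume "x \<in> tline p (axis i 1) \<inter> tline p (axis j 1)"
    then obtain s t where x: "x = torus_proj (p + s *\<^sub>R axis i 1)" "x = torus_proj (p + t *\<^sub>R axis j 1)"
      unfolding tline_def by blast
    then have "s *\<^sub>R axis i 1 + (- t) *\<^sub>R axis j 1 \<in> (lattice :: (real ^ 'n) set)"
      using torus_proj_eq_lattice[of "p + s *\<^sub>R axis i 1" "p + t *\<^sub>R axis j 1"] by simp
    then have "s \<in> \<int>"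
      using axis_comb_lattice[OF assms, of s "- t"] by blast
    then show "x \<in> {torus_proj p}"
      by (simp add: x(1) torus_proj_eq_lattice lattice_closed)
  qed
qed (simp add: tline_base)

text \<open>
  The irrational line returns to the coordinate line whenever its \<open>j\<close>-th coordinate is an integer \<open>k\<close>
  relative to \<open>p\<close>. Consecutive returns are shifted by the irrational number \<open>1/\<alpha>\<close>, so no point repeats.
\<close>

lemma irrational_meets_coordinate_line:
  fixes p x :: "real ^ 'n::finite"
  assumes ij: "i \<noteq> j" and \<alpha>: "\<alpha> \<notin> \<rat>" and x: "x = p + s *\<^sub>R axis i 1 + t *\<^sub>R axis j 1"
  shows "infinite (tline x (axis i 1 + \<alpha> *\<^sub>R axis j 1) \<inter> tline p (axis i 1))"
proof -
  have "\<alpha> \<noteq> 0"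
    using \<alpha> by auto
  define P where "P k = torus_proj (p + (s + (of_nat k - t) / \<alpha>) *\<^sub>R axis i 1)" for k :: nat
  have "P k \<in> tline x (axis i 1 + \<alpha> *\<^sub>R axis j 1)" for k
  proof -
    have "x + ((of_nat k - t) / \<alpha>) *\<^sub>R (axis i 1 + \<alpha> *\<^sub>R axis j 1)
        - (p + (s + (of_nat k - t) / \<alpha>) *\<^sub>R axis i 1) = of_nat k *\<^sub>R axis j 1"
      using \<open>\<alpha> \<noteq> 0\<close> by (simp add: x scaleR_add_right) (simp add: algebra_simps)
    then have "P k = torus_proj (x + ((of_nat k - t) / \<alpha>) *\<^sub>R (axis i 1 + \<alpha> *\<^sub>R axis j 1))"
      unfolding P_def by (metis torus_proj_eq_lattice lattice_closed(4,5) Ints_of_nat)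
    then show ?thesis
      by (simp add: tline_def)
  qed
  moreover have "P k \<in> tline p (axis i 1)" for k
    by (simp add: P_def tline_def)
  ultimately have "range P \<subseteq> tline x (axis i 1 + \<alpha> *\<^sub>R axis j 1) \<inter> tline p (axis i 1)"
    by blast
  moreover have "inj P"
  proof (rule injI, rule ccontr)
    fix k l
    assume "P k = P l" "k \<noteq> l"
    then have "((of_nat k - of_nat l) / \<alpha>) *\<^sub>R axis i 1 + 0 *\<^sub>R axis j 1 \<in> (lattice :: (real ^ 'n) set)"
      by (simp add: P_def torus_proj_eq_lattice diff_divide_distrib flip: scaleR_diff_left)
    then have "(of_nat k - of_nat l) / \<alpha> \<in> \<int>"
      using axis_comb_lattice[OF ij] by blast
    moreover have "\<alpha> = (of_nat k - of_nat l) / ((of_nat k - of_nat l) / \<alpha>)"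
      using \<open>k \<noteq> l\<close> by simp
    ultimately have "\<alpha> \<in> \<rat>"
      by (metis Ints_subset_Rats Rats_diff Rats_divide Rats_of_nat subsetD)
    then show False
      using \<alpha> by simp
  qed
  ultimately show ?thesis
    using finite_subset range_inj_infinite by blast
qed

locale torus_line_map =
  fixes f :: "'n::finite torus \<Rightarrow> 'n torus"
  assumes bij: "bij f"
    and line: "torus_line l \<Longrightarrow> torus_line (f ` l)"
begin

lemma inj: "inj f"
  using bij by (rule bij_is_inj)

lemma image_tline:
  assumes "u \<noteq> 0"
  shows "\<exists>q w. w \<noteq> 0 \<and> f ` tline p u = tline q w"
  using line[of "tline p u"] assms unfolding torus_line_iff by blast

text \<open>
  The line with direction \<open>e\<^sub>i + 2 e\<^sub>j\<close> meets the coordinate line in \<open>p\<close> and in \<open>p + e\<^sub>i / 2\<close>, but only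
  finitely often, so the same holds for the images.
\<close>

lemma coordinate_line_image:
  fixes p p' :: "real ^ 'n"
  assumes ij: "i \<noteq> j" and p': "torus_proj p' = f (torus_proj p)"
  obtains a where "a \<in> lattice" "a \<noteq> 0" "\<And>s. s *\<^sub>R a \<in> lattice \<Longrightarrow> s \<in> \<int>"
    "f ` tline p (axis i 1) = tline p' a"
proof -
  define e :: "real ^ 'n" where "e = axis i 1"
  define v :: "real ^ 'n" where "v = axis i 1 + 2 *\<^sub>R axis j 1"
  have ev: "s *\<^sub>R e + t *\<^sub>R v = (s + t) *\<^sub>R axis i 1 + (2 * t) *\<^sub>R axis j 1" for s t
    by (simp add: e_def v_def algebra_simps)
  have "indep2 e v"
    unfolding indep2_def
  proof (intro allI impI)
    fix s t
    assume "s *\<^sub>R e + t *\<^sub>R v = 0"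
    then have "s + t = 0" "2 * t = 0"
      using axis_comb_nth[OF ij, of "s + t" "2 * t"] unfolding ev by (metis zero_index)+
    then show "s = 0 \<and> t = 0"
      by simp
  qed
  have "e \<in> lattice" "v \<in> lattice"
    by (simp_all add: e_def v_def lattice_closed)
  then have fin: "finite (tline p e \<inter> tline p v)"
    using finite_meet_rational_lines \<open>indep2 e v\<close> by blast
  define y where "y = torus_proj (p + (1 / 2) *\<^sub>R e)"
  have "(1 / 2) *\<^sub>R e + 0 *\<^sub>R axis j 1 \<notin> lattice"
    using axis_comb_lattice[OF ij, of "1 / 2" 0] by (auto simp: e_def elim!: Ints_cases)
  then have "y \<noteq> torus_proj p"
    by (simp add: y_def torus_proj_eq_lattice)
  have "(1 / 2) *\<^sub>R v - (1 / 2) *\<^sub>R e = axis j 1"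
    by (simp add: e_def v_def algebra_simps)
  then have "y = torus_proj (p + (1 / 2) *\<^sub>R v)"
    unfolding y_def by (subst eq_commute) (simp add: torus_proj_eq_lattice lattice_closed)
  then have "y \<in> tline p v"
    unfolding tline_def by blast
  moreover have "y \<in> tline p e"
    unfolding tline_def y_def by blast
  ultimately have y: "y \<in> tline p e \<inter> tline p v"
    by blast
  have "e \<noteq> 0" "v \<noteq> 0"
    using \<open>indep2 e v\<close> by (rule indep2_nonzero)+
  obtain q u where u: "u \<noteq> 0" "f ` tline p e = tline q u"
    using image_tline[OF \<open>e \<noteq> 0\<close>, of p] by blast
  obtain r w where w: "f ` tline p v = tline r w"
    using image_tline[OF \<open>v \<noteq> 0\<close>, of p] by blast
  have meet: "tline q u \<inter> tline r w = f ` (tline p e \<inter> tline p v)"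
    using inj by (simp add: image_Int u w)
  have "rational_dir u"
  proof (rule rational_dir_if_finite_meet)
    show "finite (tline q u \<inter> tline r w)"
      using fin by (simp add: meet)
    show "f y \<in> tline q u \<inter> tline r w" "f (torus_proj p) \<in> tline q u \<inter> tline r w"
      using y tline_base unfolding meet by blast+
    show "f y \<noteq> f (torus_proj p)"
      using \<open>y \<noteq> torus_proj p\<close> inj by (simp add: inj_eq)
  qed
  then obtain c where c: "c \<noteq> 0" "c *\<^sub>R u \<in> lattice" "\<And>s. s *\<^sub>R (c *\<^sub>R u) \<in> lattice \<Longrightarrow> s \<in> \<int>"
    using primitive_multiple u(1) by metis
  have "torus_proj p' \<in> f ` tline p e"
    unfolding p' using tline_base by blast
  then have "tline q u = tline p' u"
    using u(2) tline_rebase by simp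
  then have "f ` tline p e = tline p' (c *\<^sub>R u)"
    using u(2) tline_scale[OF c(1), of p' u] by simp
  then show ?thesis
    using that[of "c *\<^sub>R u"] c u(1) by (simp add: e_def)
qed

text \<open>
  The coordinate lines meet in a single point, hence so do their images; this makes the primitive
  directions \<open>a\<close> and \<open>b\<close> a basis of the lattice points in the plane that they span, so that \<open>E'\<close> below
  is a parametrization of a two-dimensional torus. It remains to see that the coordinate plane is
  mapped into this torus, as a map of planes that preserves lines.
\<close>

lemma coordinate_plane_affine:
  fixes p p' :: "real ^ 'n"
  assumes ij: "i \<noteq> j" and p': "torus_proj p' = f (torus_proj p)"
  shows "\<exists>a b. \<forall>s t. f (torus_proj (p + s *\<^sub>R axis i 1 + t *\<^sub>R axis j 1)) = torus_proj (p' + s *\<^sub>R a + t *\<^sub>R b)"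
proof -
  obtain a where a: "a \<in> lattice" "a \<noteq> 0" "\<And>s. s *\<^sub>R a \<in> lattice \<Longrightarrow> s \<in> \<int>"
      and fa: "f ` tline p (axis i 1) = tline p' a"
    by (rule coordinate_line_image[OF ij p']) blast
  obtain b where b: "b \<in> lattice" "b \<noteq> 0" "\<And>s. s *\<^sub>R b \<in> lattice \<Longrightarrow> s \<in> \<int>"
      and fb: "f ` tline p (axis j 1) = tline p' b"
    by (rule coordinate_line_image[OF ij[symmetric] p']) blast
  have meet: "tline p' a \<inter> tline p' b = {torus_proj p'}"
    using inj coordinate_lines_meet[OF ij, of p] by (simp add: p' flip: fa fb image_Int)
  have ab_Ints: "s \<in> \<int> \<and> t \<in> \<int>" if "s *\<^sub>R a + t *\<^sub>R b \<in> lattice" for s t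
  proof -
    have eq: "torus_proj (p' + s *\<^sub>R a) = torus_proj (p' + (- t) *\<^sub>R b)"
      using that by (simp add: torus_proj_eq_lattice)
    have "torus_proj (p' + s *\<^sub>R a) \<in> tline p' a" "torus_proj (p' + (- t) *\<^sub>R b) \<in> tline p' b"
      unfolding tline_def by blast+
    then have "torus_proj (p' + s *\<^sub>R a) = torus_proj p'" "torus_proj (p' + (- t) *\<^sub>R b) = torus_proj p'"
      using eq meet by auto
    then have "s \<in> \<int>" "- t \<in> \<int>"
      using a(3)[of s] b(3)[of "- t"] by (simp_all only: torus_proj_eq_lattice add_diff_cancel_left')
    then show ?thesis
      using Ints_minus[of "- t"] by simp
  qed
  then have ab_lattice: "s *\<^sub>R a + t *\<^sub>R b \<in> lattice \<longleftrightarrow> s \<in> \<int> \<and> t \<in> \<int>" for s t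
    using a(1) b(1) by (auto intro: lattice_closed)
  have ind: "indep2 a b"
    unfolding indep2_def
  proof (intro allI impI)
    fix s t
    assume "s *\<^sub>R a + t *\<^sub>R b = 0"
    then have "(r * s) *\<^sub>R a + (r * t) *\<^sub>R b = 0" for r
      by (metis scaleR_add_right scaleR_scaleR scaleR_zero_right)
    then have "r * s \<in> \<int> \<and> r * t \<in> \<int>" for r
      using ab_Ints lattice_closed(1) by metis
    then show "s = 0 \<and> t = 0"
      using int_multiples_zero by blast
  qed
  define E where "E s t = torus_proj (p + s *\<^sub>R axis i 1 + t *\<^sub>R axis j 1)" for s t
  define E' where "E' s t = torus_proj (p' + s *\<^sub>R a + t *\<^sub>R b)" for s t
  obtain \<alpha> :: real where \<alpha>: "\<alpha> \<notin> \<rat>"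
    using exists_irrational by blast
  \<comment> \<open>Through each point of the plane runs a line of slope \<open>\<alpha>\<close>, whose image must lie in the target plane.\<close>
  have plane: "\<exists>s' t'. f (E s t) = E' s' t'" for s t
  proof -
    define x where "x = p + s *\<^sub>R axis i 1 + t *\<^sub>R axis j 1"
    define w :: "real ^ 'n" where "w = axis i 1 + \<alpha> *\<^sub>R axis j 1"
    have "w $ i = 1"
      using ij by (simp add: w_def axis_def)
    then have "w \<noteq> 0"
      by auto
    have "\<alpha> \<noteq> 0" "1 / \<alpha> \<notin> \<rat>"
      using \<alpha> Rats_divide[of 1 "1 / \<alpha>"] by auto
    have "tline x w = tline x (axis j 1 + (1 / \<alpha>) *\<^sub>R axis i 1)"
      using tline_scale[of "1 / \<alpha>" x w] \<open>\<alpha> \<noteq> 0\<close> by (simp add: w_def algebra_simps)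
    moreover have "x = p + t *\<^sub>R axis j 1 + s *\<^sub>R axis i 1"
      by (simp add: x_def)
    ultimately have inf: "infinite (tline x w \<inter> tline p (axis i 1))" "infinite (tline x w \<inter> tline p (axis j 1))"
      using irrational_meets_coordinate_line[OF ij \<alpha> x_def]
        irrational_meets_coordinate_line[OF ij[symmetric] \<open>1 / \<alpha> \<notin> \<rat>\<close>, of x p t s]
      by (simp_all add: w_def)
    obtain q v where v: "v \<noteq> 0" "f ` tline x w = tline q v"
      using image_tline[OF \<open>w \<noteq> 0\<close>, of x] by blast
    have inf': "infinite (tline p' a \<inter> tline q v)" "infinite (tline p' b \<inter> tline q v)"
      using inf inj by (simp_all add: finite_image_iff inj_on_subset Int_commute flip: v(2) fa fb image_Int)
    \<comment> \<open>A rational line that meets both image lines infinitely often would be parallel to both.\<close>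
    have irr: "\<not> rational_dir v"
    proof
      assume "rational_dir v"
      then obtain c where c: "c \<noteq> 0" "c *\<^sub>R v \<in> lattice"
        unfolding rational_dir_def by blast
      then have "\<not> indep2 a (c *\<^sub>R v)" "\<not> indep2 b (c *\<^sub>R v)"
        using inf' finite_meet_rational_lines[of _ "c *\<^sub>R v" p' q] a(1) b(1) tline_scale[OF c(1)] by metis+
      then obtain r r' where r: "c *\<^sub>R v = r *\<^sub>R a" "c *\<^sub>R v = r' *\<^sub>R b"
        using dependent_multiple a(2) b(2) by metis
      then have "r *\<^sub>R a + (- r') *\<^sub>R b = 0"
        by simp
      then have "r = 0"
        using ind unfolding indep2_def by blast
      then show False
        using r(1) c(1) v(1) by simp
    qed
    have two: "\<exists>x\<in>A. \<exists>y\<in>A. x \<noteq> y" if "infinite A" for A :: "'n torus set"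
      using that by (metis finite.emptyI finite_insert insertI1 insert_subset rev_finite_subset singletonI subsetI)
    obtain c1 s1 z1 where 1: "c1 \<noteq> 0" "z1 \<in> lattice" "c1 *\<^sub>R v = s1 *\<^sub>R a + z1"
      using two[OF inf'(1)] two_meets_direction by metis
    obtain c2 s2 z2 where 2: "c2 \<noteq> 0" "z2 \<in> lattice" "c2 *\<^sub>R v = s2 *\<^sub>R b + z2"
      using two[OF inf'(2)] two_meets_direction by metis
    obtain s0 t0 where st: "v = s0 *\<^sub>R a + t0 *\<^sub>R b"
      using irrational_direction_in_plane[OF a(1) b(1) ind 1 2 irr] by blast
    obtain r where r: "torus_proj (p' + r *\<^sub>R a) \<in> tline q v"
      using two[OF inf'(1)] unfolding tline_def by blast
    have "f (torus_proj x) \<in> tline (p' + r *\<^sub>R a) v"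
      using tline_base[of x w] v(2) tline_rebase[OF r] by blast
    then obtain k where "f (torus_proj x) = torus_proj (p' + r *\<^sub>R a + k *\<^sub>R v)"
      unfolding tline_def by blast
    then have "f (E s t) = E' (r + k * s0) (k * t0)"
      by (simp add: E_def E'_def x_def st algebra_simps)
    then show ?thesis by blast
  qed
  have pline_E: "pline E x y u v = tline (p + x *\<^sub>R axis i 1 + y *\<^sub>R axis j 1) (u *\<^sub>R axis i 1 + v *\<^sub>R axis j 1)" for x y u v
    by (simp add: pline_def tline_def E_def algebra_simps)
  have pline_E': "pline E' x y u v = tline (p' + x *\<^sub>R a + y *\<^sub>R b) (u *\<^sub>R a + v *\<^sub>R b)" for x y u v
    by (simp add: pline_def tline_def E'_def algebra_simps)
  interpret torus_plane_map E E' f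
  proof
    fix s t s' t'
    have "p + s *\<^sub>R axis i 1 + t *\<^sub>R axis j 1 - (p + s' *\<^sub>R axis i 1 + t' *\<^sub>R axis j 1)
      = (s - s') *\<^sub>R axis i 1 + (t - t') *\<^sub>R axis j 1"
      by (simp add: algebra_simps)
    then show "E s t = E s' t' \<longleftrightarrow> s - s' \<in> \<int> \<and> t - t' \<in> \<int>"
      by (simp only: E_def torus_proj_eq_lattice axis_comb_lattice[OF ij])
    have "p' + s *\<^sub>R a + t *\<^sub>R b - (p' + s' *\<^sub>R a + t' *\<^sub>R b) = (s - s') *\<^sub>R a + (t - t') *\<^sub>R b"
      by (simp add: algebra_simps)
    then show "E' s t = E' s' t' \<longleftrightarrow> s - s' \<in> \<int> \<and> t - t' \<in> \<int>"
      by (simp only: E'_def torus_proj_eq_lattice ab_lattice)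
  next
    fix u v x y :: real
    assume uv: "(u, v) \<noteq> (0, 0)"
    define d :: "real ^ 'n" where "d = u *\<^sub>R axis i 1 + v *\<^sub>R axis j 1"
    have "d $ i = u" "d $ j = v"
      unfolding d_def using axis_comb_nth[OF ij] by blast+
    then have "d \<noteq> 0"
      using uv by auto
    obtain q w where w: "w \<noteq> 0" "f ` pline E x y u v = tline q w"
      using image_tline[OF \<open>d \<noteq> 0\<close>] unfolding pline_E d_def[symmetric] by blast
    obtain x' y' where xy': "f (E x y) = E' x' y'"
      using plane by blast
    have "f (E x y) \<in> tline q w"
      using pline_memI[of E x 0 u y v] w(2) by auto
    then have qw: "tline q w = tline (p' + x' *\<^sub>R a + y' *\<^sub>R b) w"
      unfolding xy' E'_def by (rule tline_rebase)
    obtain N :: "real ^ 'n \<Rightarrow> real ^ 'n" where N: "linear N" "\<And>x. x \<in> lattice \<Longrightarrow> N x \<in> lattice"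
        "\<And>x. N x = 0 \<longleftrightarrow> (\<exists>s t. x = s *\<^sub>R a + t *\<^sub>R b)"
      by (rule lattice_plane_equations[OF a(1) b(1) ind]) blast
    \<comment> \<open>The image line stays in the plane modulo the lattice, so \<open>N\<close> maps all real multiples of \<open>w\<close> to lattice vectors.\<close>
    have "N w = 0"
    proof -
      have "r *\<^sub>R N w \<in> lattice" for r
      proof -
        have "torus_proj (p' + x' *\<^sub>R a + y' *\<^sub>R b + r *\<^sub>R w) \<in> f ` pline E x y u v"
          unfolding w(2) qw unfolding tline_def by blast
        then obtain k where "torus_proj (p' + x' *\<^sub>R a + y' *\<^sub>R b + r *\<^sub>R w) = f (E (x + k * u) (y + k * v))"
          unfolding pline_def by blast
        then obtain s t where "torus_proj (p' + x' *\<^sub>R a + y' *\<^sub>R b + r *\<^sub>R w) = E' s t"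
          using plane[of "x + k * u" "y + k * v"] by auto
        then have "r *\<^sub>R w + ((x' - s) *\<^sub>R a + (y' - t) *\<^sub>R b) \<in> lattice"
          by (simp add: E'_def torus_proj_eq_lattice algebra_simps)
        then have "N (r *\<^sub>R w + ((x' - s) *\<^sub>R a + (y' - t) *\<^sub>R b)) \<in> lattice"
          by (rule N(2))
        moreover have "N ((x' - s) *\<^sub>R a + (y' - t) *\<^sub>R b) = 0"
          using N(3) by blast
        ultimately show ?thesis
          using N(1) by (simp add: linear_add linear_cmul)
      qed
      then have "r * N w $ k \<in> \<int>" for r k
        by (simp add: lattice_def)
      then show ?thesis
        by (simp add: vec_eq_iff int_multiples_zero)
    qed
    then obtain u' v' where "w = u' *\<^sub>R a + v' *\<^sub>R b"
      using N(3) by blast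
    then have "f ` pline E x y u v = pline E' x' y' u' v'" "(u', v') \<noteq> (0, 0)"
      using w qw by (auto simp: pline_E')
    then show "\<exists>x' y' u' v'. (u', v') \<noteq> (0, 0) \<and> f ` pline E x y u v = pline E' x' y' u' v'"
      by blast
  next
    show "inj f" by (rule inj)
    show "f ` pline E 0 0 1 0 = pline E' 0 0 1 0" "f ` pline E 0 0 0 1 = pline E' 0 0 0 1"
      using fa fb by (simp_all add: pline_E pline_E')
    show "f (E 0 0) = E' 0 0"
      by (simp add: E_def E'_def p')
  qed
  obtain c d where "\<And>s t. f (E s t) = E' (c * s) (d * t)"
    using linear_in_coordinates by blast
  then have "f (E s t) = torus_proj (p' + s *\<^sub>R (c *\<^sub>R a) + t *\<^sub>R (d *\<^sub>R b))" for s t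
    by (simp add: E'_def mult.commute)
  then show ?thesis
    unfolding E_def by blast
qed

end

section \<open>Assembling the coordinate planes\<close>

text \<open>
  The slopes are determined by the values in the torus, since a lattice vector all of whose real
  multiples are lattice vectors is zero.
\<close>

lemma slope_unique:
  fixes a a' :: "real ^ 'n::finite"
  assumes "\<And>t. torus_proj (q + t *\<^sub>R a) = torus_proj (q + t *\<^sub>R a')"
  shows "a = a'"
proof -
  have "t *\<^sub>R (a - a') \<in> lattice" for t
    using assms[of t] by (simp add: torus_proj_eq_lattice scaleR_diff_right)
  then have Z: "t * (a $ k - a' $ k) \<in> \<int>" for t k
    by (simp add: lattice_def)
  have "a $ k - a' $ k = 0" for k
    using Z by (rule int_multiples_zero)
  then show ?thesis
    by (simp add: vec_eq_iff)
qed

theorem theorem1p4: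
  fixes f :: "'n::finite torus \<Rightarrow> 'n torus"
  assumes "CARD('n) \<ge> 2"
    and "bij f"
    and "\<And>l. torus_line l \<Longrightarrow> torus_line (f ` l)"
  shows "torus_affine f"
proof -
  interpret torus_line_map f
    using assms(2,3) by unfold_locales
  obtain q where q: "torus_proj q = f (torus_proj 0)"
    using surj_torus_proj by (metis surjD)
  have other: "\<exists>j. j \<noteq> i" for i :: 'n
  proof (rule ccontr)
    assume "\<nexists>j. j \<noteq> i"
    then have "(UNIV :: 'n set) = {i}"
      by auto
    then have "CARD('n) = 1"
      by (metis card_1_singleton_iff One_nat_def)
    then show False
      using assms(1) by simp
  qed
  have "\<exists>a. \<forall>t. f (torus_proj (t *\<^sub>R axis i 1)) = torus_proj (q + t *\<^sub>R a)" for i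
  proof -
    obtain j where "i \<noteq> j"
      using other by metis
    then obtain a b where ab: "\<And>s t. f (torus_proj (0 + s *\<^sub>R axis i 1 + t *\<^sub>R axis j 1)) = torus_proj (q + s *\<^sub>R a + t *\<^sub>R b)"
      using coordinate_plane_affine q by metis
    show ?thesis
      using ab[of _ 0] by (intro exI[of _ a]) simp
  qed
  then obtain a where a: "\<And>i t. f (torus_proj (t *\<^sub>R axis i 1)) = torus_proj (q + t *\<^sub>R a i)"
    by metis
  have sum: "f (torus_proj ((\<Sum>i\<in>S. x i *\<^sub>R axis i 1) + t *\<^sub>R axis j 1))
    = torus_proj (q + (\<Sum>i\<in>S. x i *\<^sub>R a i) + t *\<^sub>R a j)" if "finite S" "j \<notin> S" for S x t j
    using that
  proof (induction S arbitrary: t j rule: finite_induct)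
    case empty
    show ?case by (simp add: a)
  next
    case (insert k S)
    define p where "p = (\<Sum>i\<in>S. x i *\<^sub>R axis i (1::real))"
    define p' where "p' = q + (\<Sum>i\<in>S. x i *\<^sub>R a i)"
    have jk: "k \<noteq> j" "j \<notin> S"
      using insert.prems by auto
    have IH: "f (torus_proj (p + t *\<^sub>R axis l 1)) = torus_proj (p' + t *\<^sub>R a l)" if "l \<notin> S" for t l
      using insert.IH[OF that] by (simp add: p_def p'_def)
    have "torus_proj p' = f (torus_proj p)"
      using IH[OF jk(2), of 0] by simp
    then obtain b c where bc: "\<And>s t. f (torus_proj (p + s *\<^sub>R axis k 1 + t *\<^sub>R axis j 1)) = torus_proj (p' + s *\<^sub>R b + t *\<^sub>R c)"
      using coordinate_plane_affine[OF jk(1)] by metis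
    \<comment> \<open>The induction hypothesis covers both axes of the new plane through \<open>p\<close>, which fixes its slopes.\<close>
    have "b = a k"
      by (rule slope_unique[of p']) (use bc[of _ 0] IH[OF insert.hyps(2)] in simp)
    moreover have "c = a j"
      by (rule slope_unique[of p']) (use bc[of 0] IH[OF jk(2)] in simp)
    moreover have "(\<Sum>i\<in>insert k S. x i *\<^sub>R axis i 1) + t *\<^sub>R axis j 1 = p + x k *\<^sub>R axis k 1 + t *\<^sub>R axis j 1"
      "q + (\<Sum>i\<in>insert k S. x i *\<^sub>R a i) + t *\<^sub>R a j = p' + x k *\<^sub>R a k + t *\<^sub>R a j"
      using insert.hyps by (simp_all add: p_def p'_def)
    ultimately show ?case
      by (simp add: bc)
  qed
  define A :: "real ^ 'n ^ 'n" where "A = (\<chi> k i. a i $ k)"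
  have "f (torus_proj x) = torus_proj (A *v x + q)" for x
  proof -
    obtain j :: 'n where True by simp
    have split: "(\<Sum>i\<in>UNIV. g i) = (\<Sum>i\<in>UNIV - {j}. g i) + g j" for g :: "'n \<Rightarrow> real ^ 'n"
      by (simp add: sum.remove[of UNIV j] add.commute)
    have x: "x = (\<Sum>i\<in>UNIV. x $ i *\<^sub>R axis i 1)"
      using basis_expansion[of x] by (simp add: scalar_mult_eq_scaleR)
    have "A *v x = (\<Sum>i\<in>UNIV. x $ i *\<^sub>R a i)"
      by (simp add: vec_eq_iff A_def matrix_vector_mult_def mult.commute)
    then show ?thesis
      using sum[of "UNIV - {j}" j "\<lambda>i. x $ i" "x $ j"] x
      unfolding split by (simp add: add.commute add.left_commute)
  qed
  then show ?thesis
    unfolding torus_affine_def by (metis UNIV_I open_UNIV)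
qed

end
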